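(* For every integer $k \geq 1$ and every complex $q$ with $|q|<1$, \[ \sum_{n = 1}^\infty \mathrm{FFW}_k (n) q^n =(-1)^k q^{k(k-1)/2}\sum_{n = k}^\infty \begin{bmatrix} n-1 \\ k-1\end{bmatrix}_q n q^n (q^{n + 1};q)_\infty =-\sum_{i = 0}^{k - 1} (-1)^i \frac{q^{i(i + 1)/2}}{(q;q)_i} \left(\sum_{n = 1}^\infty d(n) q^n - \sum_{n = 1}^{k - i - 1} \frac{q^n}{1 - q^n}\right). \]
   Context: For a positive integer $n$, $\mathcal{D}(n)$ denotes the set of partitions of $n$ into distinct parts; for $\pi \in \mathcal{D}(n)$, $\#(\pi)$ is the number of parts of $\pi$ and $s_k(\pi)$ is the $k$th smallest part of $\pi$, with the convention $s_k(\pi)=0$ if $\pi$ has fewer than $k$ parts. Define $\mathrm{FFW}_k(n) := \sum_{\pi \in \mathcal{D}(n)} (-1)^{\#(\pi)} s_k(\pi)$ for $n\ge 1$. Here $(a;q)_n=(1-a)(1-aq)\cdots(1-aq^{n-1})$, $(a;q)_0=1$, $(a;q)_\infty=\prod_{j\ge0}(1-aq^j)$; the $q$-binomial coefficient is $\begin{bmatrix} n \\ k\end{bmatrix}_q = \frac{(q;q)_n}{(q;q)_k (q;q)_{n-k}}$ for $n\ge k$ and $0$ for $n<k$; $d(n)$ is the number of positive divisors of $n$. *)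

theory Defs
  imports "HOL-Analysis.Analysis"
begin

text \<open>A partition of \<open>n\<close> into distinct parts is determined by its set of parts,
  a finite set of positive integers with sum \<open>n\<close>.\<close>

definition distinct_partitions :: "nat \<Rightarrow> nat set set" where
  "distinct_partitions n = {\<pi>. finite \<pi> \<and> 0 \<notin> \<pi> \<and> \<Sum>\<pi> = n}"

text \<open>The \<open>k\<close>-th smallest part, counted from \<open>k = 1\<close> (list indices start at 0).\<close>

definition kth_smallest_part :: "nat \<Rightarrow> nat set \<Rightarrow> nat" where
  "kth_smallest_part k \<pi> = (if card \<pi> < k then 0 else sorted_list_of_set \<pi> ! (k - 1))"

definition FFW :: "nat \<Rightarrow> nat \<Rightarrow> int" where
  "FFW k n = (\<Sum>\<pi>\<in>distinct_partitions n. (-1) ^ card \<pi> * int (kth_smallest_part k \<pi>))"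

definition qpochhammer :: "complex \<Rightarrow> complex \<Rightarrow> nat \<Rightarrow> complex" where
  "qpochhammer a q n = (\<Prod>j<n. 1 - a * q ^ j)"

definition qpochhammer_inf :: "complex \<Rightarrow> complex \<Rightarrow> complex" where
  "qpochhammer_inf a q = (\<Prod>j. 1 - a * q ^ j)"

definition qbinomial :: "complex \<Rightarrow> nat \<Rightarrow> nat \<Rightarrow> complex" where
  "qbinomial q n k =
    (if n < k then 0
     else qpochhammer q q n / (qpochhammer q q k * qpochhammer q q (n - k)))"

definition num_divisors :: "nat \<Rightarrow> nat" where
  "num_divisors n = card {d. d dvd n}"

text \<open>The sum in \<^const>\<open>FFW\<close> is over a finite set, and the infinite product converges, so
  neither takes a default value.\<close>

lemma finite_distinct_partitions: "finite (distinct_partitions n)"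
proof (rule finite_subset)
  show "distinct_partitions n \<subseteq> Pow {..n}"
    unfolding distinct_partitions_def using member_le_sum[of _ _ "\<lambda>x::nat. x"] by fastforce
qed simp

lemma qpochhammer_inf_has_prod:
  assumes "norm q < 1"
  shows "(\<lambda>j. 1 - a * q ^ j) has_prod qpochhammer_inf a q"
proof -
  have "summable (\<lambda>j. norm ((1 - a * q ^ j) - 1))"
    using assms by (simp add: norm_mult norm_power summable_mult)
  then have "convergent_prod (\<lambda>j. 1 - a * q ^ j)"
    by (intro abs_convergent_prod_imp_convergent_prod summable_imp_abs_convergent_prod)
  then show ?thesis
    unfolding qpochhammer_inf_def by (rule convergent_prod_has_prod)
qed

lemma qpochhammer_self_nonzero:
  assumes "norm q < 1"
  shows "qpochhammer q q n \<noteq> 0"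
proof -
  have "norm (q ^ Suc j) < 1" for j
    using assms by (cases "q = 0") (auto simp: norm_mult norm_power intro: power_Suc_less_one[simplified])
  then have "q * q ^ j \<noteq> 1" for j
    by (metis norm_one order_less_irrefl power_Suc)
  then show ?thesis by (simp add: qpochhammer_def)
qed

end

theory Submission
  imports Defs
begin

text \<open>Write \<open>(q)\<^sub>n\<close> for \<open>(q;q)\<^sub>n\<close>, and let \<open>G(N)\<close> be the sum of \<open>(-1)\<^bsup>#\<pi>\<^esup> s\<^sub>k(\<pi>) q\<^bsup>|\<pi>|\<^esup>\<close>
  over the sets of parts \<open>\<pi> \<subseteq> {1..N}\<close>. Deciding whether \<open>N + 1\<close> is a part gives
  \<open>G(N + 1) = (1 - q\<^bsup>N+1\<^esup>) G(N) + (-1)\<^sup>k (N + 1) q\<^bsup>N+1\<^esup> e\<^bsub>k-1\<^esub>(q, \<dots>, q\<^sup>N)\<close>, so \<open>G(N) / (q)\<^sub>N\<close> is a partial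
  sum of the \<open>q\<close>-binomial series divided by \<open>(q)\<^sub>\<infinity>\<close>; letting \<open>N\<close> tend to infinity is the first identity.

  For the second one, put \<open>b\<^sub>j = (-1)\<^sup>j q\<^bsup>j(j+1)/2\<^esup> / (q)\<^sub>j\<close>. By the \<open>q\<close>-Pascal rule the \<open>m\<close>-th term is
  \<open>- m \<Sum>\<^bsub>j<k\<^esub> b\<^sub>j q\<^bsup>m-j\<^esup> / (q)\<^bsub>m-j\<^esub>\<close> (without the factor \<open>(q)\<^sub>\<infinity>\<close>), so the series equals
  \<open>- \<Sum>\<^bsub>j<k\<^esub> b\<^sub>j (D + j)\<close> with \<open>D = \<Sum> d(n) q\<^sup>n\<close>, because \<open>\<Sum> q\<^sup>n / (q)\<^sub>n = 1 / (q)\<^sub>\<infinity>\<close> and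
  \<open>\<Sum> n q\<^sup>n / (q)\<^sub>n = D / (q)\<^sub>\<infinity>\<close>. Newton's identities for \<open>q, q\<^sup>2, q\<^sup>3, \<dots>\<close> turn \<open>\<Sum> j b\<^sub>j\<close> into the
  finite sums of \<open>q\<^sup>n / (1 - q\<^sup>n)\<close>.\<close>

subsection \<open>Distinct partitions\<close>

lemma sum_Pow_insert:
  fixes f :: "'a set \<Rightarrow> 'b::comm_monoid_add"
  assumes "finite A" "a \<notin> A"
  shows "sum f (Pow (insert a A)) = sum f (Pow A) + (\<Sum>X\<in>Pow A. f (insert a X))"
proof -
  have "inj_on (insert a) (Pow A)"
    using assms(2) by (auto simp: inj_on_def)
  moreover have "Pow A \<inter> insert a ` Pow A = {}"
    using assms(2) by auto
  ultimately show ?thesis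
    using assms(1) by (simp add: Pow_insert sum.union_disjoint sum.reindex)
qed

text \<open>A new largest part goes to the end of the sorted list, so index \<open>k\<close> shows
  it only if exactly \<open>k\<close> parts precede it. With fewer parts both sides take the default
  value 0.\<close>

lemma kth_smallest_part_insert:
  assumes "finite \<pi>" "\<And>x. x \<in> \<pi> \<Longrightarrow> x < m"
  shows "kth_smallest_part (Suc k) (insert m \<pi>) =
    (if card \<pi> = k then m else kth_smallest_part (Suc k) \<pi>)"
proof -
  have m: "m \<notin> \<pi>" using assms(2) by blast
  have "sorted_list_of_set (insert m \<pi>) = sorted_list_of_set \<pi> @ [m]"
    using assms m by (subst sorted_list_of_set_unique[symmetric])
      (auto simp: sorted_wrt_append)
  then show ?thesis
    using assms(1) m by (auto simp: kth_smallest_part_def nth_append)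
qed

lemma kth_smallest_part_le:
  assumes "\<pi> \<in> distinct_partitions n" "k \<ge> 1"
  shows "kth_smallest_part k \<pi> \<le> n"
proof (cases "card \<pi> < k")
  case False
  have fin: "finite \<pi>" and n: "n = \<Sum>\<pi>" using assms(1) by (auto simp: distinct_partitions_def)
  have "sorted_list_of_set \<pi> ! (k - 1) \<in> set (sorted_list_of_set \<pi>)"
    using False assms(2) by (intro nth_mem) simp
  then have "kth_smallest_part k \<pi> \<in> \<pi>"
    using False fin by (simp add: kth_smallest_part_def)
  then show ?thesis unfolding n using member_le_sum[of _ \<pi> "\<lambda>x. x"] fin by blast
qed (simp add: kth_smallest_part_def)

text \<open>No part exceeds the sum of all parts. Hence the coefficient of \<open>q ^ n\<close> in
  the sum over subsets of \<open>{1..N}\<close> is final as soon as \<open>N\<close> reaches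
  \<open>n\<close>.\<close>

lemma distinct_partitions_eq:
  assumes "n \<le> N"
  shows "distinct_partitions n = {\<pi> \<in> Pow {1..N}. \<Sum>\<pi> = n}"
proof -
  have "\<pi> \<subseteq> {1..N}" if "finite \<pi>" "0 \<notin> \<pi>" "\<Sum>\<pi> = n" for \<pi>
  proof
    fix x assume x: "x \<in> \<pi>"
    then have "x \<le> \<Sum>\<pi>"
      using that member_le_sum[of x \<pi> "\<lambda>x. x"] by simp
    moreover have "x \<noteq> 0" using x that(2) by metis
    ultimately show "x \<in> {1..N}" using that assms by simp
  qed
  moreover have "finite \<pi> \<and> 0 \<notin> \<pi>" if "\<pi> \<subseteq> {1..N}" for \<pi>
    using that by (auto intro: finite_subset)
  ultimately have "finite \<pi> \<and> 0 \<notin> \<pi> \<and> \<Sum>\<pi> = n \<longleftrightarrow> \<pi> \<in> Pow {1..N} \<and> \<Sum>\<pi> = n" for \<pi>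
    unfolding Pow_iff by metis
  then show ?thesis
    unfolding distinct_partitions_def by (rule Collect_cong)
qed

section \<open>A summable majorant for the generating function\<close>

lemma summable_index_mult_power:
  fixes x :: real
  assumes "0 \<le> x" "x < 1"
  shows "summable (\<lambda>n. n * x ^ n)"
proof (rule summable_comparison_test')
  show "summable (\<lambda>n. Suc n * x ^ n)"
    using geometric_deriv_sums[of x] assms by (auto simp: sums_iff)
  show "norm (n * x ^ n) \<le> Suc n * x ^ n" if "n \<ge> 0" for n
    using assms by (simp add: mult_right_mono)
qed

text \<open>The left side is one graded piece of the product of the factors
  \<open>1 + y ^ j\<close>, which is bounded by the exponential of a geometric series.\<close>

lemma card_distinct_partitions_le:
  fixes y :: real
  assumes "0 < y" "y < 1"
  shows "card (distinct_partitions n) * y ^ n \<le> exp (1 / (1 - y))"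
proof -
  have "card (distinct_partitions n) * y ^ n = (\<Sum>\<pi>\<in>distinct_partitions n. y ^ \<Sum>\<pi>)"
    by (simp add: distinct_partitions_def)
  also have "\<dots> \<le> (\<Sum>\<pi>\<in>Pow {1..n}. y ^ \<Sum>\<pi>)"
    using assms by (intro sum_mono2) (auto simp: distinct_partitions_eq[of n n])
  also have "\<dots> = (\<Prod>j=1..n. y ^ j + 1)"
    by (simp add: prod_add power_sum)
  also have "\<dots> \<le> exp (\<Sum>j=1..n. y ^ j)"
    using assms prod_le_exp_sum[of "{1..n}" "\<lambda>j. y ^ j"] by (simp add: add.commute)
  also have "(\<Sum>j=1..n. y ^ j) \<le> (\<Sum>j. y ^ j)"
    using assms by (intro sum_le_suminf summable_geometric) auto
  also have "(\<Sum>j. y ^ j) = 1 / (1 - y)"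
    using assms by (intro suminf_geometric) auto
  finally show ?thesis by simp
qed

lemma summable_card_distinct_partitions:
  fixes x :: real
  assumes "0 \<le> x" "x < 1"
  shows "summable (\<lambda>n. card (distinct_partitions n) * (n * x ^ n))"
proof -
  \<comment> \<open>A point strictly between \<open>x\<close> and 1: the count times
    \<open>y ^ n\<close> stays bounded, and \<open>(x / y) ^ n\<close> still decays
    geometrically.\<close>
  define y where "y = (1 + x) / 2"
  have y: "0 < y" "y < 1" "x < y" using assms by (auto simp: y_def)
  have "summable (\<lambda>n. exp (1 / (1 - y)) * (n * (x / y) ^ n))"
    using y assms by (intro summable_mult summable_index_mult_power) auto
  then show ?thesis
  proof (rule summable_comparison_test'[where N = 0])
    fix n
    have "card (distinct_partitions n) * (n * x ^ n)
        = (card (distinct_partitions n) * y ^ n) * (n * (x / y) ^ n)"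
      using y by (simp add: power_divide)
    also have "\<dots> \<le> exp (1 / (1 - y)) * (n * (x / y) ^ n)"
      using y assms by (intro mult_right_mono card_distinct_partitions_le) auto
    finally show "norm (card (distinct_partitions n) * (n * x ^ n)) \<le> exp (1 / (1 - y)) * (n * (x / y) ^ n)"
      using assms by simp
  qed
qed

subsection \<open>Euler coefficients\<close>

text \<open>These are the coefficients of \<open>z ^ j\<close> in Euler's expansion of the infinite
  product \<open>(z q; q)\<close>, bracketed as in the final identity.\<close>

definition euler_coeff :: "complex \<Rightarrow> nat \<Rightarrow> complex" where
  "euler_coeff q j = (-1) ^ j * (q ^ (j * (j + 1) div 2) / qpochhammer q q j)"

lemma triangular_Suc: "Suc n * (Suc n + 1) div 2 = n * (n + 1) div 2 + Suc n"
proof -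
  have "Suc n * (Suc n + 1) = n * (n + 1) + 2 * Suc n" by simp
  then show ?thesis by (simp only: div_mult_self2[of 2, simplified] add.commute)
qed

lemma qpochhammer_0 [simp]: "qpochhammer a q 0 = 1"
  by (simp add: qpochhammer_def)

lemma qpochhammer_self_Suc: "qpochhammer q q (Suc n) = qpochhammer q q n * (1 - q ^ Suc n)"
  by (simp add: qpochhammer_def)

context
  fixes q :: complex
  assumes q: "norm q < 1"
begin

lemma one_minus_power_neq_0: "1 - q ^ Suc n \<noteq> 0"
  using qpochhammer_self_nonzero[OF q, of "Suc n"] unfolding qpochhammer_self_Suc by simp

lemma qpochhammer_LIMSEQ: "qpochhammer q q \<longlonglongrightarrow> qpochhammer_inf q q"
  using has_prod_imp_tendsto'[OF qpochhammer_inf_has_prod[OF q, of q]]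
  by (simp add: qpochhammer_def[abs_def])

lemma qpochhammer_inf_neq_0: "qpochhammer_inf q q \<noteq> 0"
  unfolding qpochhammer_inf_def
proof (rule prodinf_nonzero)
  show "convergent_prod (\<lambda>j. 1 - q * q ^ j)"
    using qpochhammer_inf_has_prod[OF q, of q] by (simp add: has_prod_iff)
  show "1 - q * q ^ i \<noteq> 0" for i
    using one_minus_power_neq_0[of i] by simp
qed

text \<open>Splitting off the first \<open>n\<close> factors of the product trades the tail in the
  theorem for division by \<open>qpochhammer q q n\<close>.\<close>

lemma qpochhammer_inf_shift:
  "qpochhammer_inf (q ^ Suc n) q = qpochhammer_inf q q / qpochhammer q q n"
proof -
  have nz: "1 - q * q ^ i \<noteq> 0" for i
    using one_minus_power_neq_0[of i] by simp
  have "(\<lambda>i. 1 - q * q ^ (i + n)) has_prod qpochhammer_inf (q ^ Suc n) q"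
    using qpochhammer_inf_has_prod[OF q, of "q ^ Suc n"] by (simp add: power_add mult_ac)
  then have "(\<lambda>i. 1 - q * q ^ i) has_prod (qpochhammer_inf (q ^ Suc n) q * qpochhammer q q n)"
    using has_prod_iff_shift[of n "\<lambda>i. 1 - q * q ^ i"] nz by (simp add: qpochhammer_def)
  then have "qpochhammer_inf q q = qpochhammer_inf (q ^ Suc n) q * qpochhammer q q n"
    using qpochhammer_inf_has_prod[OF q, of q] has_prod_unique2 by blast
  then show ?thesis
    using qpochhammer_self_nonzero[OF q, of n] by (simp add: field_simps)
qed

section \<open>q-binomial coefficients and the two q-Pascal rules\<close>

lemma qbinomial_add:
  "qbinomial q (k + d) k = qpochhammer q q (k + d) / (qpochhammer q q k * qpochhammer q q d)"
  by (simp add: qbinomial_def)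

lemma qbinomial_self [simp]: "qbinomial q n n = 1"
  using qpochhammer_self_nonzero[OF q] by (simp add: qbinomial_def)

lemma qbinomial_0_right [simp]: "qbinomial q n 0 = 1"
  using qpochhammer_self_nonzero[OF q] by (simp add: qbinomial_def)

lemma qbinomial_eq_0 [simp]: "n < k \<Longrightarrow> qbinomial q n k = 0"
  by (simp add: qbinomial_def)

text \<open>With \<open>x = q ^ Suc k\<close> and \<open>y = q ^ Suc d\<close>, the two rules come
  from splitting \<open>1 - x * y\<close> as \<open>x * (1 - y) + (1 - x)\<close> and as
  \<open>(1 - y) + y * (1 - x)\<close>. The boundary cases follow from the values 0 and 1.\<close>

lemma qbinomial_Suc_Suc:
  "qbinomial q (Suc n) (Suc k) = q ^ Suc k * qbinomial q n (Suc k) + qbinomial q n k" (is ?A)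
  "k \<le> n \<Longrightarrow> qbinomial q (Suc n) (Suc k) = qbinomial q n (Suc k) + q ^ (n - k) * qbinomial q n k"
    (is "_ \<Longrightarrow> ?B")
proof -
  have "?A \<and> (k \<le> n \<longrightarrow> ?B)"
  proof (cases "k < n")
    case True
    then obtain d where n: "n = Suc (k + d)" using less_imp_Suc_add by blast
    define X Y K where "X = qpochhammer q q n" and "Y = qpochhammer q q d"
      and "K = qpochhammer q q k"
    define x y where "x = q ^ Suc k" and "y = q ^ Suc d"
    have 1: "qbinomial q (Suc n) (Suc k) = X * (1 - x * y) / (K * (1 - x) * (Y * (1 - y)))"
      using qbinomial_add[of "Suc k" "Suc d"]
      by (simp add: n qpochhammer_self_Suc X_def Y_def K_def x_def y_def power_add mult_ac)
    have 2: "qbinomial q n (Suc k) = X / (K * (1 - x) * Y)"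
      using qbinomial_add[of "Suc k" d]
      by (simp add: n qpochhammer_self_Suc X_def Y_def K_def x_def y_def)
    have 3: "qbinomial q n k = X / (K * (Y * (1 - y)))"
      using qbinomial_add[of k "Suc d"]
      by (simp add: n qpochhammer_self_Suc X_def Y_def K_def x_def y_def)
    have "K \<noteq> 0" "Y \<noteq> 0" "1 - x \<noteq> 0" "1 - y \<noteq> 0"
      using qpochhammer_self_nonzero[OF q] one_minus_power_neq_0
      by (auto simp: K_def Y_def x_def y_def simp del: power_Suc)
    then have "X * (1 - x * y) / (K * (1 - x) * (Y * (1 - y)))
               = x * (X / (K * (1 - x) * Y)) + X / (K * (Y * (1 - y)))"
      and "X * (1 - x * y) / (K * (1 - x) * (Y * (1 - y)))
               = X / (K * (1 - x) * Y) + y * (X / (K * (Y * (1 - y))))"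
      by (simp_all add: divide_simps) (simp_all add: algebra_simps)
    moreover have "n - k = Suc d" by (simp add: n)
    ultimately show ?thesis
      unfolding 1 2 3 x_def[symmetric] by (simp add: y_def)
  qed (cases "k = n"; simp)
  then show ?A and "k \<le> n \<Longrightarrow> ?B" by blast+
qed

lemma euler_coeff_0 [simp]: "euler_coeff q 0 = 1"
  by (simp add: euler_coeff_def)

text \<open>This first-order recursion is all that the proof of \<open>euler_coeff_newton\<close>
  uses about the coefficients, besides induction.\<close>

lemma euler_coeff_Suc: "(1 - q ^ Suc n) * euler_coeff q (Suc n) = - (q ^ Suc n * euler_coeff q n)"
proof -
  define t where "t = n * (n + 1) div 2"
  show ?thesis
    using one_minus_power_neq_0[of n] qpochhammer_self_nonzero[OF q, of n]
    unfolding euler_coeff_def triangular_Suc qpochhammer_self_Suc t_def[symmetric] power_add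
    by (simp add: divide_simps del: power_Suc) simp
qed

text \<open>Newton's identity for the elementary symmetric functions of \<open>q, q\<^sup>2, q\<^sup>3, \<dots>\<close>, which up to
  sign are the Euler coefficients; the power sums are \<open>q\<^sup>r / (1 - q\<^sup>r)\<close>.\<close>

lemma euler_coeff_newton:
  "of_nat n * euler_coeff q n = - (\<Sum>i<n. euler_coeff q i * (q ^ (n - i) / (1 - q ^ (n - i))))"
proof (induction n)
  case 0
  then show ?case by simp
next
  case (Suc n)
  define b where "b = euler_coeff q"
  define p where "p r = q ^ r / (1 - q ^ r)" for r
  have p: "p (Suc r) * (1 - q ^ Suc r) = q ^ Suc r" for r
    using one_minus_power_neq_0[of r] by (simp add: p_def)
  have p': "p (Suc r) = q ^ Suc r + p (Suc r) * q ^ Suc r" for r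
    using p[of r] by (simp add: algebra_simps)
  have b: "(1 - q ^ Suc j) * b (Suc j) = - (q ^ Suc j * b j)" for j
    unfolding b_def by (rule euler_coeff_Suc)
  \<comment> \<open>Multiplying by \<open>1 - q ^ Suc n\<close> produces the factor
    \<open>(1 - q ^ i) * b i\<close>, to which the recursion \<open>b\<close> applies.\<close>
  have split: "(1 - q ^ Suc n) * (b i * p (Suc n - i))
      = q ^ Suc n * b i + (1 - q ^ i) * b i * p (Suc n - i)" if "i \<le> n" for i
  proof -
    have e: "Suc n - i = Suc (n - i)" using that by simp
    have "q ^ Suc n = q ^ i * q ^ (Suc (n - i))"
      using that by (metis e le_SucI le_add_diff_inverse power_add)
    moreover have "p (Suc n - i) = q ^ Suc (n - i) + p (Suc n - i) * q ^ Suc (n - i)"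
      unfolding e by (rule p')
    moreover have "(1 - x * y) * (c * s) = x * y * c + (1 - x) * c * s" if "s = y + s * y"
      for x y c s :: complex
      using that by algebra
    ultimately show ?thesis by metis
  qed
  have "(1 - q ^ Suc n) * (\<Sum>i<Suc n. b i * p (Suc n - i))
      = (\<Sum>i<Suc n. q ^ Suc n * b i) + (\<Sum>i<Suc n. (1 - q ^ i) * b i * p (Suc n - i))"
    unfolding sum_distrib_left sum.distrib[symmetric] using split by (intro sum.cong) auto
  \<comment> \<open>The term \<open>i = 0\<close> vanishes because \<open>1 - q ^ 0 = 0\<close>, so
    the index can be shifted.\<close>
  also have "(\<Sum>i<Suc n. (1 - q ^ i) * b i * p (Suc n - i))
      = (\<Sum>j<n. (1 - q ^ Suc j) * b (Suc j) * p (n - j))"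
    by (subst sum.lessThan_Suc_shift) simp
  also have "\<dots> = - (\<Sum>j<n. q ^ Suc j * b j * p (n - j))"
    unfolding b by (simp add: sum_negf)
  also have "(\<Sum>i<Suc n. q ^ Suc n * b i) + \<dots>
      = q ^ Suc n * b n + (\<Sum>j<n. q ^ Suc n * b j - q ^ Suc j * b j * p (n - j))"
    by (simp add: sum_subtractf)
  \<comment> \<open>By \<open>p'\<close> at \<open>n - j\<close> the difference collapses to a
    multiple of the sum in the induction hypothesis.\<close>
  also have "(\<Sum>j<n. q ^ Suc n * b j - q ^ Suc j * b j * p (n - j))
      = (\<Sum>j<n. - (q ^ Suc n * (b j * p (n - j))))"
  proof (rule sum.cong[OF refl])
    fix j assume "j \<in> {..<n}"
    then obtain d where d: "n - j = Suc d" and n: "Suc n = Suc j + Suc d"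
      by (metis add_Suc lessThan_iff less_imp_le_nat le_add_diff_inverse Suc_diff_Suc)
    have "x * y * c - x * c * s = - (x * y * (c * s))" if "s = y + s * y" for x y c s :: complex
      using that by algebra
    then show "q ^ Suc n * b j - q ^ Suc j * b j * p (n - j) = - (q ^ Suc n * (b j * p (n - j)))"
      using p'[of d] unfolding d n power_add by blast
  qed
  also have "\<dots> = - (q ^ Suc n * (\<Sum>j<n. b j * p (n - j)))"
    by (simp add: sum_negf sum_distrib_left)
  also have "(\<Sum>j<n. b j * p (n - j)) = - (of_nat n * b n)"
    using Suc.IH by (simp add: b_def p_def)
  also have "q ^ Suc n * b n + - (q ^ Suc n * - (of_nat n * b n))
      = - ((1 - q ^ Suc n) * (of_nat (Suc n) * b (Suc n)))"
  proof -
    have "x * c + - (x * - (N * c)) = - ((1 - x) * ((1 + N) * e))" if "(1 - x) * e = - (x * c)"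
      for x c e N :: complex
      using that by algebra
    from this[OF b[of n], of "of_nat n"] show ?thesis unfolding of_nat_Suc .
  qed
  finally have "(1 - q ^ Suc n) * (\<Sum>i<Suc n. b i * p (Suc n - i))
      = (1 - q ^ Suc n) * (- (of_nat (Suc n) * b (Suc n)))" by simp
  then have "(\<Sum>i<Suc n. b i * p (Suc n - i)) = - (of_nat (Suc n) * b (Suc n))"
    using one_minus_power_neq_0[of n] mult_left_cancel by blast
  then show ?case unfolding b_def p_def by simp
qed

text \<open>Passing from \<open>k\<close> to \<open>Suc k\<close> lengthens the inner sums with
  \<open>i < k\<close> by their last term. These last terms together form Newton's identity for
  \<open>k\<close>, while the new inner sum for \<open>i = k\<close> is empty.\<close>

lemma sum_index_mult_euler_coeff:
  "(\<Sum>j<k. of_nat j * euler_coeff q j)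
     = - (\<Sum>i<k. euler_coeff q i * (\<Sum>n = 1..k - i - 1. q ^ n / (1 - q ^ n)))"
proof (induction k)
  case (Suc k)
  have "(\<Sum>i<Suc k. euler_coeff q i * (\<Sum>n = 1..Suc k - i - 1. q ^ n / (1 - q ^ n)))
      = (\<Sum>i<k. euler_coeff q i * (\<Sum>n = 1..k - i. q ^ n / (1 - q ^ n)))"
    by simp
  also have "\<dots> = (\<Sum>i<k. euler_coeff q i * (\<Sum>n = 1..k - i - 1. q ^ n / (1 - q ^ n))
                     + euler_coeff q i * (q ^ (k - i) / (1 - q ^ (k - i))))"
  proof (rule sum.cong[OF refl])
    fix i assume "i \<in> {..<k}"
    then obtain d where "k - i = Suc d" by (metis lessThan_iff Suc_diff_Suc)
    then show "euler_coeff q i * (\<Sum>n = 1..k - i. q ^ n / (1 - q ^ n))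
        = euler_coeff q i * (\<Sum>n = 1..k - i - 1. q ^ n / (1 - q ^ n))
          + euler_coeff q i * (q ^ (k - i) / (1 - q ^ (k - i)))"
      by (simp add: distrib_left del: power_Suc)
  qed
  finally show ?case
    using Suc.IH euler_coeff_newton[of k] by (simp add: sum.distrib)
qed simp

text \<open>By the first q-Pascal rule, the left sides for \<open>Suc k\<close> and \<open>k\<close>
  differ exactly by the new summand \<open>j = Suc k\<close>. The guard \<open>j \<le> m\<close>
  excludes truncated differences \<open>m - j\<close>.\<close>

lemma qbinomial_expansion:
  assumes "m \<ge> 1"
  shows "(-1) ^ Suc k * q ^ (k * (k + 1) div 2) * qbinomial q (m - 1) k * q ^ m / qpochhammer q q m
    = - (\<Sum>j<Suc k. if j \<le> m then euler_coeff q j * (q ^ (m - j) / qpochhammer q q (m - j)) else 0)"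
proof (induction k)
  case 0
  then show ?case by simp
next
  case (Suc k)
  obtain l where m: "m = Suc l" using assms by (cases m) auto
  define t where "t = k * (k + 1) div 2"
  have step: "q ^ (t + Suc k) * qbinomial q l (Suc k) * q ^ m / qpochhammer q q m
      + q ^ t * qbinomial q l k * q ^ m / qpochhammer q q m
     = (if Suc k \<le> m then q ^ (t + Suc k) / qpochhammer q q (Suc k)
           * (q ^ (m - Suc k) / qpochhammer q q (m - Suc k)) else 0)"
  proof -
    have "q ^ (t + Suc k) * qbinomial q l (Suc k) * q ^ m / qpochhammer q q m
        + q ^ t * qbinomial q l k * q ^ m / qpochhammer q q m
      = q ^ t * q ^ m * qbinomial q m (Suc k) / qpochhammer q q m"
      unfolding m qbinomial_Suc_Suc(1) by (simp add: power_add add_divide_distrib algebra_simps)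
    also have "\<dots> = (if Suc k \<le> m then q ^ (t + Suc k) / qpochhammer q q (Suc k)
           * (q ^ (m - Suc k) / qpochhammer q q (m - Suc k)) else 0)"
    proof (cases "Suc k \<le> m")
      case True
      then obtain d where d: "m = Suc k + d" using le_Suc_ex by blast
      have "x * (y * z) * (M / (K * D)) / M = x * y / K * (z / D)" if "M \<noteq> 0"
        for x y z M K D :: complex
        using that by simp
      from this[OF qpochhammer_self_nonzero[OF q]] show ?thesis
        using True unfolding d qbinomial_add power_add by simp
    qed simp
    finally show ?thesis .
  qed
  have "(-1) ^ Suc (Suc k) * q ^ (t + Suc k) * qbinomial q (m - 1) (Suc k) * q ^ m / qpochhammer q q m
      = (-1) ^ k * (q ^ (t + Suc k) * qbinomial q l (Suc k) * q ^ m / qpochhammer q q m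
          + q ^ t * qbinomial q l k * q ^ m / qpochhammer q q m)
        + (-1) ^ Suc k * q ^ t * qbinomial q (m - 1) k * q ^ m / qpochhammer q q m"
    by (simp add: m distrib_left)
  also have "\<dots> = - (\<Sum>j<Suc (Suc k). if j \<le> m
      then euler_coeff q j * (q ^ (m - j) / qpochhammer q q (m - j)) else 0)"
    unfolding step sum.lessThan_Suc[of _ "Suc k"] minus_add_distrib Suc.IH[folded t_def]
      euler_coeff_def[of _ "Suc k"] triangular_Suc t_def[symmetric]
    by (simp del: power_Suc sum.lessThan_Suc) simp
  finally show ?case unfolding triangular_Suc t_def .
qed

subsection \<open>Euler series and the divisor function\<close>

text \<open>The limit \<open>qpochhammer_inf q q\<close> is nonzero, so the reciprocals converge.
  The bound lets both Euler series converge on the whole open unit disc.\<close>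

lemma inverse_qpochhammer_bounded:
  obtains C where "C > 0" "\<And>n. norm (1 / qpochhammer q q n) \<le> C"
proof -
  have "(\<lambda>n. 1 / qpochhammer q q n) \<longlonglongrightarrow> 1 / qpochhammer_inf q q"
    by (intro tendsto_intros qpochhammer_LIMSEQ qpochhammer_inf_neq_0)
  then have "Bseq (\<lambda>n. 1 / qpochhammer q q n)"
    using convergent_imp_Bseq convergent_def by blast
  then show ?thesis using that unfolding Bseq_def by blast
qed

lemma summable_weighted_euler:
  assumes "norm z < 1"
  shows "summable (\<lambda>n. of_nat n / qpochhammer q q n * z ^ n)"
proof -
  obtain C where C: "\<And>n. norm (1 / qpochhammer q q n) \<le> C"
    using inverse_qpochhammer_bounded by metis
  show ?thesis
  proof (rule summable_comparison_test')
    show "summable (\<lambda>n. C * (of_nat n * norm z ^ n))"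
      by (intro summable_mult summable_index_mult_power norm_ge_zero assms)
    show "norm (of_nat n / qpochhammer q q n * z ^ n) \<le> C * (of_nat n * norm z ^ n)"
      if "n \<ge> 0" for n
      using mult_right_mono[OF C[of n], of "of_nat n * norm z ^ n"]
      by (simp add: norm_mult norm_divide norm_power mult_ac)
  qed
qed

lemma summable_euler:
  assumes "norm z < 1"
  shows "summable (\<lambda>n. 1 / qpochhammer q q n * z ^ n)"
proof -
  obtain C where C: "\<And>n. norm (1 / qpochhammer q q n) \<le> C"
    using inverse_qpochhammer_bounded by metis
  show ?thesis
  proof (rule summable_comparison_test')
    show "summable (\<lambda>n. C * norm z ^ n)"
      by (intro summable_mult summable_geometric) (simp add: assms)
    show "norm (1 / qpochhammer q q n * z ^ n) \<le> C * norm z ^ n" if "n \<ge> 0" for n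
      using mult_right_mono[OF C[of n], of "norm z ^ n"]
      by (simp add: norm_mult norm_divide norm_power mult_ac)
  qed
qed

definition euler_series :: "complex \<Rightarrow> complex" where
  "euler_series z = (\<Sum>n. 1 / qpochhammer q q n * z ^ n)"

text \<open>This is \<open>z d/dz\<close> applied to \<open>euler_series\<close>; its value at
  \<open>q\<close> carries the divisor function.\<close>

definition weighted_euler_series :: "complex \<Rightarrow> complex" where
  "weighted_euler_series z = (\<Sum>n. of_nat n / qpochhammer q q n * z ^ n)"

lemma inverse_qpochhammer_diff:
  "1 / qpochhammer q q (Suc n) * (1 - q ^ Suc n) = 1 / qpochhammer q q n"
  using one_minus_power_neq_0[of n] by (simp add: qpochhammer_self_Suc)

lemma norm_mult_q_less_1: "norm z < 1 \<Longrightarrow> norm (q * z) < 1"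
  using q mult_strict_mono'[of "norm q" 1 "norm z" 1] by (simp add: norm_mult)

text \<open>In the difference of the values at \<open>z\<close> and \<open>q * z\<close>, the factor
  \<open>1 - q ^ Suc n\<close> cancels the last factor of the denominator, leaving the original
  series shifted by one.\<close>

lemma euler_series_mult_q:
  assumes z: "norm z < 1"
  shows "euler_series (q * z) = (1 - z) * euler_series z"
proof -
  let ?f = "\<lambda>n. 1 / qpochhammer q q n * z ^ n - 1 / qpochhammer q q n * (q * z) ^ n"
  have "?f sums (euler_series z - euler_series (q * z))"
    unfolding euler_series_def
    by (intro sums_diff summable_sums summable_euler norm_mult_q_less_1 z)
  then have "(\<lambda>n. ?f (Suc n)) sums (euler_series z - euler_series (q * z))"
    by (subst sums_Suc_iff) simp
  moreover have "?f (Suc n) = z * (1 / qpochhammer q q n * z ^ n)" for n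
  proof -
    have "r * y - r * (x * y) = y * (r * (1 - x))" for r x y :: complex by algebra
    from this[of "1 / qpochhammer q q (Suc n)" "z ^ Suc n" "q ^ Suc n"] show ?thesis
      unfolding inverse_qpochhammer_diff power_mult_distrib by simp
  qed
  ultimately have "(\<lambda>n. z * (1 / qpochhammer q q n * z ^ n)) sums (euler_series z - euler_series (q * z))"
    by simp
  moreover have "(\<lambda>n. z * (1 / qpochhammer q q n * z ^ n)) sums (z * euler_series z)"
    unfolding euler_series_def by (intro sums_mult summable_sums summable_euler z)
  ultimately have "z * euler_series z = euler_series z - euler_series (q * z)"
    using sums_unique2 by blast
  then show ?thesis by (simp add: algebra_simps)
qed

text \<open>The cancellation is that of \<open>euler_series_mult_q\<close>; after the shift the
  weight \<open>n + 1\<close> splits into \<open>n\<close> and 1, and the 1 contributes the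
  unweighted series.\<close>

lemma weighted_euler_series_mult_q:
  assumes z: "norm z < 1"
  shows "weighted_euler_series (q * z) = (1 - z) * weighted_euler_series z - z * euler_series z"
proof -
  let ?f = "\<lambda>n. of_nat n / qpochhammer q q n * z ^ n - of_nat n / qpochhammer q q n * (q * z) ^ n"
  let ?g = "\<lambda>n. z * (of_nat n / qpochhammer q q n * z ^ n + 1 / qpochhammer q q n * z ^ n)"
  have "?f sums (weighted_euler_series z - weighted_euler_series (q * z))"
    unfolding weighted_euler_series_def
    by (intro sums_diff summable_sums summable_weighted_euler norm_mult_q_less_1 z)
  then have "(\<lambda>n. ?f (Suc n)) sums (weighted_euler_series z - weighted_euler_series (q * z))"
    by (subst sums_Suc_iff) simp
  moreover have "?f (Suc n) = ?g n" for n
  proof -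
    have "c / r * y - c / r * (x * y) = c * y * (1 / r * (1 - x))" for c r x y :: complex
      by (simp add: algebra_simps diff_divide_distrib)
    from this[of "of_nat (Suc n)" "qpochhammer q q (Suc n)" "z ^ Suc n" "q ^ Suc n"] show ?thesis
      unfolding inverse_qpochhammer_diff power_mult_distrib by (simp add: algebra_simps add_divide_distrib)
  qed
  ultimately have "?g sums (weighted_euler_series z - weighted_euler_series (q * z))"
    by simp
  moreover have "?g sums (z * (weighted_euler_series z + euler_series z))"
    unfolding euler_series_def weighted_euler_series_def
    by (intro sums_mult sums_add summable_sums summable_euler summable_weighted_euler z)
  ultimately have "z * (weighted_euler_series z + euler_series z)
      = weighted_euler_series z - weighted_euler_series (q * z)"
    using sums_unique2 by blast
  then show ?thesis by (simp add: algebra_simps)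
qed

text \<open>The series telescopes: the term of index \<open>Suc N\<close> is the difference of the
  reciprocals of \<open>qpochhammer q q\<close> at \<open>Suc N\<close> and
  \<open>N\<close>.\<close>

lemma euler_series_sums: "(\<lambda>n. 1 / qpochhammer q q n * q ^ n) sums (1 / qpochhammer_inf q q)"
proof -
  have "(\<Sum>n\<le>N. 1 / qpochhammer q q n * q ^ n) = 1 / qpochhammer q q N" for N
  proof (induction N)
    case (Suc N)
    have "1 / qpochhammer q q N + 1 / qpochhammer q q (Suc N) * q ^ Suc N = 1 / qpochhammer q q (Suc N)"
      unfolding inverse_qpochhammer_diff[of N, symmetric] by (simp only: ring_distribs) simp
    then show ?case using Suc.IH by simp
  qed simp
  moreover have "(\<lambda>n. 1 / qpochhammer q q n) \<longlonglongrightarrow> 1 / qpochhammer_inf q q"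
    by (intro tendsto_intros qpochhammer_LIMSEQ qpochhammer_inf_neq_0)
  ultimately show ?thesis by (simp add: sums_def_le)
qed

lemma norm_power_Suc_less_1: "norm (q ^ Suc n) < 1"
  using q power_Suc_less_one[of "norm q" n] by (cases "q = 0") (auto simp: norm_mult norm_power)

lemma euler_series_power: "euler_series (q ^ Suc n) = qpochhammer q q n / qpochhammer_inf q q"
proof (induction n)
  case 0
  then show ?case using euler_series_sums by (simp add: euler_series_def sums_iff)
next
  case (Suc n)
  have "euler_series (q ^ Suc (Suc n)) = (1 - q ^ Suc n) * euler_series (q ^ Suc n)"
    using euler_series_mult_q[OF norm_power_Suc_less_1, of n] by simp
  then show ?case by (simp only: Suc.IH qpochhammer_self_Suc) simp
qed

text \<open>Iterating the functional equation, each step from \<open>z = q ^ Suc n\<close> to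
  \<open>q * z\<close> adds one Lambert term \<open>z / (1 - z)\<close>.\<close>

lemma weighted_euler_series_power:
  "weighted_euler_series (q ^ Suc n)
    = qpochhammer q q n * (weighted_euler_series q
        - (\<Sum>j<n. q ^ Suc j / (1 - q ^ Suc j)) / qpochhammer_inf q q)"
proof (induction n)
  case (Suc n)
  define z A P S where "z = q ^ Suc n" and "A = qpochhammer q q n" and "P = qpochhammer_inf q q"
    and "S = (\<Sum>j<n. q ^ Suc j / (1 - q ^ Suc j))"
  have "weighted_euler_series (q ^ Suc (Suc n)) = (1 - z) * weighted_euler_series z - z * euler_series z"
    using weighted_euler_series_mult_q[OF norm_power_Suc_less_1, of n] by (simp add: z_def)
  also have "\<dots> = (1 - z) * (A * (weighted_euler_series q - S / P)) - z * (A / P)"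
    by (simp only: z_def Suc.IH euler_series_power A_def P_def S_def)
  also have "\<dots> = A * (1 - z) * (weighted_euler_series q - (S + z / (1 - z)) / P)"
    using one_minus_power_neq_0[of n] qpochhammer_inf_neq_0
    unfolding z_def[symmetric] P_def[symmetric]
    by (simp add: divide_simps) (simp add: algebra_simps)
  finally show ?case
    by (simp only: qpochhammer_self_Suc sum.lessThan_Suc A_def z_def P_def S_def)
qed simp

text \<open>Since \<open>q ^ Suc n\<close> tends to 0, where the weighted series vanishes, the
  bracket in \<open>weighted_euler_series_power\<close> must tend to 0.\<close>

lemma lambert_LIMSEQ: 
  "(\<lambda>n. \<Sum>j<n. q ^ Suc j / (1 - q ^ Suc j)) \<longlonglongrightarrow> qpochhammer_inf q q * weighted_euler_series q"
proof -
  have "summable (\<lambda>n. of_nat n / qpochhammer q q n * (1/2) ^ n)"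
    by (rule summable_weighted_euler) (simp add: norm_divide)
  then have "isCont weighted_euler_series 0"
    unfolding weighted_euler_series_def[abs_def] by (rule isCont_powser) (simp add: norm_divide)
  moreover have "(\<lambda>n. q ^ Suc n) \<longlonglongrightarrow> 0"
    using LIMSEQ_power_zero[OF q] by (rule LIMSEQ_Suc)
  ultimately have "(\<lambda>n. weighted_euler_series (q ^ Suc n)) \<longlonglongrightarrow> weighted_euler_series 0"
    by (rule isCont_tendsto_compose)
  moreover have "weighted_euler_series 0 = 0"
    unfolding weighted_euler_series_def by (subst powser_zero) simp
  ultimately have "(\<lambda>n. weighted_euler_series (q ^ Suc n) / qpochhammer q q n)
      \<longlonglongrightarrow> 0 / qpochhammer_inf q q"
    by (intro tendsto_divide qpochhammer_LIMSEQ qpochhammer_inf_neq_0) simp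
  then have "(\<lambda>n. qpochhammer_inf q q * (weighted_euler_series q
        - weighted_euler_series (q ^ Suc n) / qpochhammer q q n))
      \<longlonglongrightarrow> qpochhammer_inf q q * (weighted_euler_series q - 0 / qpochhammer_inf q q)"
    by (intro tendsto_mult tendsto_diff tendsto_const)
  moreover have "qpochhammer_inf q q * (weighted_euler_series q
        - weighted_euler_series (q ^ Suc n) / qpochhammer q q n)
      = (\<Sum>j<n. q ^ Suc j / (1 - q ^ Suc j))" for n
    unfolding weighted_euler_series_power
    using qpochhammer_self_nonzero[OF q, of n] qpochhammer_inf_neq_0 by simp
  ultimately show ?thesis by simp
qed

section \<open>From Lambert series to the divisor function\<close>

lemma num_divisors_eq_card:
  assumes "n > 0" "n \<le> N"
  shows "card {j. j < N \<and> Suc j dvd n} = num_divisors n"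
proof -
  have "{d. d dvd n} = Suc ` {j. j < N \<and> Suc j dvd n}"
  proof (intro equalityI subsetI)
    fix d assume "d \<in> {d. d dvd n}"
    then have "d dvd n" "d > 0" "d \<le> n" using assms by (auto intro: dvd_imp_le gr0I)
    then show "d \<in> Suc ` {j. j < N \<and> Suc j dvd n}"
      using assms by (intro image_eqI[of _ _ "d - 1"]) auto
  qed auto
  then show ?thesis by (simp add: num_divisors_def card_image)
qed

text \<open>A geometric series in \<open>q ^ Suc j\<close>, spread over the positive multiples of
  \<open>Suc j\<close>.\<close>

lemma sums_lambert_term:
  "(\<lambda>n. if n > 0 \<and> Suc j dvd n then q ^ n else 0) sums (q ^ Suc j / (1 - q ^ Suc j))"
proof -
  define g where "g i = Suc j * Suc i" for i
  have "(\<lambda>i. q ^ Suc j * (q ^ Suc j) ^ i) sums (q ^ Suc j * (1 / (1 - q ^ Suc j)))"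
    by (intro sums_mult geometric_sums norm_power_Suc_less_1)
  moreover have "q ^ Suc j * (q ^ Suc j) ^ i = (if g i > 0 \<and> Suc j dvd g i then q ^ g i else 0)" for i
  proof -
    have "g i > 0" "Suc j dvd g i" unfolding g_def by (simp, rule dvd_triv_left)
    moreover have "q ^ g i = q ^ Suc j * (q ^ Suc j) ^ i" by (simp only: g_def power_mult power_Suc)
    ultimately show ?thesis by simp
  qed
  ultimately have "(\<lambda>i. if g i > 0 \<and> Suc j dvd g i then q ^ g i else 0)
      sums (q ^ Suc j / (1 - q ^ Suc j))"
    by simp
  moreover have "strict_mono g"
    by (intro strict_monoI) (simp add: g_def del: mult_Suc)
  moreover have "(if n > 0 \<and> Suc j dvd n then q ^ n else 0) = 0" if "n \<notin> range g" for n
  proof -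
    have "n \<in> range g" if n: "n > 0" "Suc j dvd n"
    proof -
      obtain c where c: "n = Suc j * c" using n(2) by (rule dvdE)
      then obtain i where "c = Suc i" using n(1) by (cases c) auto
      then show ?thesis using c by (auto simp only: g_def)
    qed
    then show ?thesis using that by auto
  qed
  ultimately show ?thesis
    using sums_mono_reindex[of g "\<lambda>n. if n > 0 \<and> Suc j dvd n then q ^ n else 0"] by blast
qed

lemma num_divisors_series_sums:
  "(\<lambda>n. of_nat (num_divisors (Suc n)) * q ^ Suc n)
     sums (qpochhammer_inf q q * weighted_euler_series q)"
proof -
  \<comment> \<open>The coefficientwise limit in \<open>N\<close> is exchanged with the sum over
    \<open>n\<close> by Tannery's theorem. The guard \<open>n > 0\<close> matters: every
    \<open>Suc j\<close> divides 0, so \<open>a 0 N\<close> would grow like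
    \<open>N\<close>.\<close>
  define a where "a n N = (\<Sum>j<N. if n > 0 \<and> Suc j dvd n then q ^ n else 0)" for n N
  define c where "c n = (if n > 0 then of_nat (num_divisors n) * q ^ n else 0)" for n
  have a: "a n N = (if n > 0 then of_nat (card {j. j < N \<and> Suc j dvd n}) * q ^ n else 0)" for n N
    by (simp add: a_def sum.If_cases Int_def)
  have lim: "a n \<longlonglongrightarrow> c n" for n
  proof (rule tendsto_eventually)
    show "\<forall>\<^sub>F N in sequentially. a n N = c n"
      using eventually_ge_at_top[of n]
      by eventually_elim (simp add: a c_def num_divisors_eq_card)
  qed
  have bound: "norm (a n N) \<le> of_nat n * norm q ^ n" for n N
  proof (cases "n > 0")
    case True
    then have "{j. j < N \<and> Suc j dvd n} \<subseteq> {..<n}"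
      by (auto dest: dvd_imp_le)
    then have "card {j. j < N \<and> Suc j dvd n} \<le> n"
      by (metis card_lessThan card_mono finite_lessThan)
    then show ?thesis
      using True by (simp add: a norm_mult norm_power mult_right_mono)
  qed (simp add: a)
  have tan: "summable (\<lambda>n. norm (c n)) \<and> (\<lambda>N. \<Sum>n. a n N) \<longlonglongrightarrow> (\<Sum>n. c n)"
    using tannerys_theorem[of a c sequentially "\<lambda>n. of_nat n * norm q ^ n"] lim
      always_eventually[of "\<lambda>(n, N). norm (a n N) \<le> of_nat n * norm q ^ n"] bound
      summable_index_mult_power[OF norm_ge_zero q] by auto
  have "(\<lambda>n. a n N) sums (\<Sum>j<N. q ^ Suc j / (1 - q ^ Suc j))" for N
    unfolding a_def by (intro sums_sum sums_lambert_term)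
  then have "(\<lambda>N. \<Sum>n. a n N) = (\<lambda>N. \<Sum>j<N. q ^ Suc j / (1 - q ^ Suc j))"
    by (auto simp: sums_iff)
  then have "(\<Sum>n. c n) = qpochhammer_inf q q * weighted_euler_series q"
    using tan lambert_LIMSEQ LIMSEQ_unique by metis
  moreover have "summable c"
    using tan summable_norm_cancel by blast
  ultimately have "c sums (qpochhammer_inf q q * weighted_euler_series q)"
    by (simp add: sums_iff)
  then have "(\<lambda>n. c (Suc n)) sums (qpochhammer_inf q q * weighted_euler_series q)"
    by (subst sums_Suc_iff) (simp add: c_def)
  then show ?thesis by (simp add: c_def)
qed

subsection \<open>The generating function of the \<open>k\<close>-th smallest parts\<close>

text \<open>Here and below \<open>k\<close> is shifted by one: these terms belong to the \<open>(k + 1)\<close>-th smallest part.\<close>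

definition kth_part_term :: "nat \<Rightarrow> nat \<Rightarrow> complex" where
  "kth_part_term k m = (-1) ^ Suc k * q ^ (k * (k + 1) div 2) * qbinomial q (m - 1) k
     * of_nat m * q ^ m / qpochhammer q q m"

text \<open>After expanding and substituting \<open>m = n + j\<close>, the weight \<open>m\<close>
  splits into \<open>n\<close> and \<open>j\<close>, which give the weighted and the plain Euler
  series at \<open>q\<close>.\<close>

lemma kth_part_term_sums:
  "kth_part_term k sums
     (- (\<Sum>j<Suc k. euler_coeff q j * (weighted_euler_series q + of_nat j / qpochhammer_inf q q)))"
proof -
  define f where "f j m = (if j \<le> m then of_nat m * (euler_coeff q j * (q ^ (m - j) / qpochhammer q q (m - j))) else 0)"
    for j m
  have eq: "kth_part_term k m = - (\<Sum>j<Suc k. f j m)" for m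
  proof (cases "m \<ge> 1")
    case True
    have "kth_part_term k m = of_nat m * ((-1) ^ Suc k * q ^ (k * (k + 1) div 2)
        * qbinomial q (m - 1) k * q ^ m / qpochhammer q q m)"
      by (simp add: kth_part_term_def mult_ac)
    also have "\<dots> = - (\<Sum>j<Suc k. f j m)"
      unfolding qbinomial_expansion[OF True] f_def mult_minus_right sum_distrib_left
      by (intro arg_cong[of _ _ uminus] sum.cong) auto
    finally show ?thesis .
  next
    \<comment> \<open>The expansion starts at \<open>m = 1\<close>; at 0, where \<open>m - 1\<close>
      truncates, the weight \<open>m\<close> makes both sides zero.\<close>
    case False
    then have "m = 0" by simp
    then show ?thesis by (simp add: kth_part_term_def f_def del: sum.lessThan_Suc)
  qed
  have "f j sums (euler_coeff q j * (weighted_euler_series q + of_nat j / qpochhammer_inf q q))" for j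
  proof -
    have "(\<lambda>n. of_nat n / qpochhammer q q n * q ^ n) sums weighted_euler_series q"
      unfolding weighted_euler_series_def by (intro summable_sums summable_weighted_euler q)
    then have "(\<lambda>n. euler_coeff q j * (of_nat n / qpochhammer q q n * q ^ n
          + of_nat j * (1 / qpochhammer q q n * q ^ n)))
        sums (euler_coeff q j * (weighted_euler_series q + of_nat j * (1 / qpochhammer_inf q q)))"
      by (intro sums_mult sums_add euler_series_sums)
    moreover have "euler_coeff q j * (of_nat n / qpochhammer q q n * q ^ n
          + of_nat j * (1 / qpochhammer q q n * q ^ n)) = f j (n + j)" for n
      by (simp add: f_def algebra_simps add_divide_distrib)
    ultimately have "(\<lambda>n. f j (n + j)) sums (euler_coeff q j * (weighted_euler_series q + of_nat j / qpochhammer_inf q q))"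
      by simp
    then show ?thesis
      by (subst (asm) sums_iff_shift) (simp add: f_def)
  qed
  then show ?thesis
    unfolding eq[abs_def] by (intro sums_minus sums_sum)
qed

text \<open>This evaluates the elementary symmetric polynomial of degree \<open>k\<close> in
  \<open>q, ..., q ^ N\<close>. Deciding whether \<open>Suc N\<close> is chosen reproduces the
  second q-Pascal rule.\<close>

lemma sum_power_subsets_of_card:
  "(\<Sum>\<pi>\<in>Pow {1..N}. if card \<pi> = k then q ^ \<Sum>\<pi> else 0)
     = q ^ (k * (k + 1) div 2) * qbinomial q N k"
proof (induction N arbitrary: k)
  case 0
  then show ?case using q by (cases k) auto
next
  case (Suc N)
  have ins: "{1..Suc N} = insert (Suc N) {1..N}" by auto
  have card: "card (insert (Suc N) \<pi>) = Suc (card \<pi>)" and sum: "\<Sum>(insert (Suc N) \<pi>) = Suc N + \<Sum>\<pi>"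
    if "\<pi> \<in> Pow {1..N}" for \<pi>
  proof -
    have "finite \<pi>" "Suc N \<notin> \<pi>" using that finite_subset[of \<pi> "{1..N}"] by auto
    then show "card (insert (Suc N) \<pi>) = Suc (card \<pi>)" "\<Sum>(insert (Suc N) \<pi>) = Suc N + \<Sum>\<pi>"
      by simp_all
  qed
  show ?case
  proof (cases k)
    case 0
    have "(\<Sum>\<pi>\<in>Pow {1..N}. if card (insert (Suc N) \<pi>) = 0 then q ^ \<Sum>(insert (Suc N) \<pi>) else 0) = 0"
      by (intro sum.neutral ballI) (simp add: card)
    then show ?thesis
      unfolding ins using 0 Suc.IH[of 0] q by (subst sum_Pow_insert) auto
  next
    case (Suc l)
    define t where "t = l * (l + 1) div 2"
    have "(\<Sum>\<pi>\<in>Pow {1..N}. if card (insert (Suc N) \<pi>) = Suc l then q ^ \<Sum>(insert (Suc N) \<pi>) else 0)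
        = (\<Sum>\<pi>\<in>Pow {1..N}. q ^ Suc N * (if card \<pi> = l then q ^ \<Sum>\<pi> else 0))"
      by (intro sum.cong refl) (simp only: card sum power_add, simp)
    also have "\<dots> = q ^ Suc N * (q ^ t * qbinomial q N l)"
      unfolding sum_distrib_left[symmetric] Suc.IH t_def ..
    finally have "(\<Sum>\<pi>\<in>Pow {1..Suc N}. if card \<pi> = k then q ^ \<Sum>\<pi> else 0)
        = q ^ (t + Suc l) * qbinomial q N (Suc l) + q ^ Suc N * (q ^ t * qbinomial q N l)"
      unfolding ins Suc by (subst sum_Pow_insert) (auto simp only: Suc.IH triangular_Suc t_def finite_atLeastAtMost atLeastAtMost_iff)
    also have "\<dots> = q ^ (t + Suc l) * qbinomial q (Suc N) (Suc l)"
    proof (cases "l \<le> N")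
      case True
      then have "q ^ Suc N = q ^ Suc l * q ^ (N - l)" by (simp flip: power_add)
      then show ?thesis
        unfolding qbinomial_Suc_Suc(2)[OF True] by (simp only: power_add) (simp add: algebra_simps)
    qed (simp add: q)
    finally show ?thesis unfolding Suc triangular_Suc t_def .
  qed
qed

lemma sum_kth_smallest_part:
  "(\<Sum>\<pi>\<in>Pow {1..N}. (-1) ^ card \<pi> * of_nat (kth_smallest_part (Suc k) \<pi>) * q ^ \<Sum>\<pi>)
     = qpochhammer q q N * (\<Sum>m\<le>N. kth_part_term k m)"
    (is "?G N = _")
proof (induction N)
  case 0
  then show ?case by (simp add: kth_smallest_part_def kth_part_term_def)
next
  case (Suc N)
  let ?f = "\<lambda>\<pi>. (-1) ^ card \<pi> * of_nat (kth_smallest_part (Suc k) \<pi>) * q ^ \<Sum>\<pi>"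
  have ins: "{1..Suc N} = insert (Suc N) {1..N}" by auto
  have "?f (insert (Suc N) \<pi>) = - (q ^ Suc N * ?f \<pi>)
      + (-1) ^ Suc k * of_nat (Suc N) * q ^ Suc N * (if card \<pi> = k then q ^ \<Sum>\<pi> else 0)"
    if "\<pi> \<in> Pow {1..N}" for \<pi>
  proof -
    have "Suc N \<notin> \<pi>" using that by auto
    have fin: "finite \<pi>" and "\<And>x. x \<in> \<pi> \<Longrightarrow> x < Suc N"
      using that finite_subset[of \<pi> "{1..N}"] by (auto simp: subset_iff less_Suc_eq_le)
    then have kth: "kth_smallest_part (Suc k) (insert (Suc N) \<pi>)
        = (if card \<pi> = k then Suc N else kth_smallest_part (Suc k) \<pi>)"
      by (rule kth_smallest_part_insert)
    \<comment> \<open>This default value makes the product with \<open>?f \<pi>\<close> vanish when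
      \<open>card \<pi> = k\<close>, so one formula covers both cases of \<open>kth\<close>.\<close>
    have "kth_smallest_part (Suc k) \<pi> = 0" if "card \<pi> = k"
      using that by (simp add: kth_smallest_part_def)
    moreover have "card (insert (Suc N) \<pi>) = Suc (card \<pi>)" "\<Sum>(insert (Suc N) \<pi>) = Suc N + \<Sum>\<pi>"
      using fin \<open>Suc N \<notin> \<pi>\<close> by simp_all
    ultimately show ?thesis
      unfolding kth by (simp add: power_add del: of_nat_Suc)
  qed
  then have "(\<Sum>\<pi>\<in>Pow {1..N}. ?f (insert (Suc N) \<pi>)) = (\<Sum>\<pi>\<in>Pow {1..N}. - (q ^ Suc N * ?f \<pi>)
      + (-1) ^ Suc k * of_nat (Suc N) * q ^ Suc N * (if card \<pi> = k then q ^ \<Sum>\<pi> else 0))"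
    by (intro sum.cong refl)
  also have "\<dots> = - (q ^ Suc N * ?G N)
      + (-1) ^ Suc k * of_nat (Suc N) * q ^ Suc N * (q ^ (k * (k + 1) div 2) * qbinomial q N k)"
    unfolding sum.distrib sum_negf sum_distrib_left[symmetric] sum_power_subsets_of_card ..
  finally have "?G (Suc N) = ?G N + (- (q ^ Suc N * ?G N)
      + (-1) ^ Suc k * of_nat (Suc N) * q ^ Suc N * (q ^ (k * (k + 1) div 2) * qbinomial q N k))"
    unfolding ins by (subst sum_Pow_insert) simp_all
  also have "(-1) ^ Suc k * of_nat (Suc N) * q ^ Suc N * (q ^ (k * (k + 1) div 2) * qbinomial q N k)
      = qpochhammer q q (Suc N) * kth_part_term k (Suc N)"
    using qpochhammer_self_nonzero[OF q, of "Suc N"]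
    by (simp add: kth_part_term_def mult_ac del: power_Suc of_nat_Suc)
  finally show ?case
    unfolding Suc.IH by (simp add: qpochhammer_self_Suc algebra_simps)
qed

lemma FFW_series_sums:
  "(\<lambda>n. of_int (FFW (Suc k) (Suc n)) * q ^ Suc n) sums (qpochhammer_inf q q * (\<Sum>m. kth_part_term k m))"
proof -
  define s :: "nat set \<Rightarrow> complex" where
    "s \<pi> = (-1) ^ card \<pi> * of_nat (kth_smallest_part (Suc k) \<pi>)" for \<pi>
  \<comment> \<open>The finite sum over subsets of \<open>{1..N}\<close> is graded by the total
    \<open>n\<close>, so that Tannery's theorem can take \<open>N\<close> to infinity under the sum
    over \<open>n\<close>.\<close>
  define a where "a n N = (\<Sum>\<pi>\<in>Pow {1..N}. if n = \<Sum>\<pi> then s \<pi> * q ^ \<Sum>\<pi> else 0)" for n N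
  define c where "c n = of_int (FFW (Suc k) n) * q ^ n" for n
  have a: "a n N = (\<Sum>\<pi> | \<pi> \<in> Pow {1..N} \<and> \<Sum>\<pi> = n. s \<pi> * q ^ n)" for n N
    unfolding a_def by (subst sum.inter_filter[symmetric]) (auto intro!: sum.cong)
  have lim: "a n \<longlonglongrightarrow> c n" for n
  proof (rule tendsto_eventually)
    show "\<forall>\<^sub>F N in sequentially. a n N = c n"
      using eventually_ge_at_top[of n]
    proof eventually_elim
      case (elim N)
      show ?case
        unfolding a c_def FFW_def distinct_partitions_eq[OF elim, symmetric]
        by (simp add: s_def sum_distrib_right)
    qed
  qed
  have bound: "norm (a n N) \<le> of_nat (card (distinct_partitions n)) * (of_nat n * norm q ^ n)" for n N
  proof -
    have sub: "{\<pi> \<in> Pow {1..N}. \<Sum>\<pi> = n} \<subseteq> distinct_partitions n"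
      by (auto simp: distinct_partitions_def intro: finite_subset)
    have "norm (a n N) \<le> (\<Sum>\<pi> | \<pi> \<in> Pow {1..N} \<and> \<Sum>\<pi> = n. of_nat n * norm q ^ n)"
      unfolding a
    proof (rule sum_norm_le)
      fix \<pi> assume "\<pi> \<in> {\<pi> \<in> Pow {1..N}. \<Sum>\<pi> = n}"
      then have "kth_smallest_part (Suc k) \<pi> \<le> n"
        using sub kth_smallest_part_le by auto
      then show "norm (s \<pi> * q ^ n) \<le> of_nat n * norm q ^ n"
        by (simp add: s_def norm_mult norm_power mult_right_mono)
    qed
    also have "\<dots> \<le> of_nat (card (distinct_partitions n)) * (of_nat n * norm q ^ n)"
      using card_mono[OF finite_distinct_partitions sub] by (simp add: mult_right_mono)
    finally show ?thesis .
  qed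
  have tan: "summable (\<lambda>n. norm (c n)) \<and> (\<lambda>N. \<Sum>n. a n N) \<longlonglongrightarrow> (\<Sum>n. c n)"
    using tannerys_theorem[of a c sequentially
        "\<lambda>n. of_nat (card (distinct_partitions n)) * (of_nat n * norm q ^ n)"]
      lim summable_card_distinct_partitions[of "norm q"] q bound
      always_eventually[of "\<lambda>(n, N). norm (a n N)
        \<le> of_nat (card (distinct_partitions n)) * (of_nat n * norm q ^ n)"] by auto
  have "(\<lambda>n. a n N) sums (qpochhammer q q N * (\<Sum>m\<le>N. kth_part_term k m))" for N
    unfolding a_def sum_kth_smallest_part[symmetric] s_def by (intro sums_sum sums_single)
  then have "(\<lambda>N. \<Sum>n. a n N) = (\<lambda>N. qpochhammer q q N * (\<Sum>m\<le>N. kth_part_term k m))"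
    by (auto simp: sums_iff)
  moreover have "(\<lambda>N. qpochhammer q q N * (\<Sum>m\<le>N. kth_part_term k m))
      \<longlonglongrightarrow> qpochhammer_inf q q * (\<Sum>m. kth_part_term k m)"
    using sums_summable[OF kth_part_term_sums[of k]]
    by (intro tendsto_mult qpochhammer_LIMSEQ summable_LIMSEQ')
  ultimately have "(\<Sum>n. c n) = qpochhammer_inf q q * (\<Sum>m. kth_part_term k m)"
    using tan LIMSEQ_unique by metis
  moreover have "summable c"
    using tan summable_norm_cancel by blast
  ultimately have "c sums (qpochhammer_inf q q * (\<Sum>m. kth_part_term k m))"
    by (simp add: sums_iff)
  moreover have "c 0 = 0"
    by (simp add: c_def FFW_def distinct_partitions_eq[of 0 0] kth_smallest_part_def)
  ultimately have "(\<lambda>n. c (Suc n)) sums (qpochhammer_inf q q * (\<Sum>m. kth_part_term k m))"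
    by (subst sums_Suc_iff) simp
  then show ?thesis by (simp add: c_def)
qed

end

theorem theorem1p1:
  fixes k :: nat and q :: complex
  assumes "k \<ge> 1" and "norm q < 1"
  shows "summable (\<lambda>n. of_int (FFW k (n + 1)) * q ^ (n + 1))
    \<and> summable (\<lambda>n. qbinomial q (n + k - 1) (k - 1) * of_nat (n + k) * q ^ (n + k)
                      * qpochhammer_inf (q ^ (n + k + 1)) q)
    \<and> summable (\<lambda>n. of_nat (num_divisors (n + 1)) * q ^ (n + 1))
    \<and> (\<Sum>n. of_int (FFW k (n + 1)) * q ^ (n + 1))
        = (-1) ^ k * q ^ (k * (k - 1) div 2)
          * (\<Sum>n. qbinomial q (n + k - 1) (k - 1) * of_nat (n + k) * q ^ (n + k)
                  * qpochhammer_inf (q ^ (n + k + 1)) q)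
    \<and> (-1) ^ k * q ^ (k * (k - 1) div 2)
          * (\<Sum>n. qbinomial q (n + k - 1) (k - 1) * of_nat (n + k) * q ^ (n + k)
                  * qpochhammer_inf (q ^ (n + k + 1)) q)
        = - (\<Sum>i = 0..k - 1. (-1) ^ i * (q ^ (i * (i + 1) div 2) / qpochhammer q q i)
              * ((\<Sum>n. of_nat (num_divisors (n + 1)) * q ^ (n + 1))
                 - (\<Sum>n = 1..k - i - 1. q ^ n / (1 - q ^ n))))"
proof -
  note q = assms(2)
  obtain l where k: "k = Suc l" using assms(1) by (cases k) auto
  define f where "f n = qbinomial q (n + k - 1) (k - 1) * of_nat (n + k) * q ^ (n + k)
                      * qpochhammer_inf (q ^ (n + k + 1)) q" for n
  define D where "D = (\<Sum>n. of_nat (num_divisors (n + 1)) * q ^ (n + 1))"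
  define P where "P = qpochhammer_inf q q"
  define C where "C = (-1) ^ k * q ^ (k * (k - 1) div 2)"
  define T where "T = (\<Sum>m. kth_part_term q l m)"
  have P: "P \<noteq> 0" unfolding P_def by (rule qpochhammer_inf_neq_0[OF q])
  have D: "summable (\<lambda>n. of_nat (num_divisors (n + 1)) * q ^ (n + 1))"
      "D = P * weighted_euler_series q q"
    using num_divisors_series_sums[OF q] by (simp_all add: sums_iff D_def P_def)
  have F: "summable (\<lambda>n. of_int (FFW k (n + 1)) * q ^ (n + 1))"
      "(\<Sum>n. of_int (FFW k (n + 1)) * q ^ (n + 1)) = P * T"
    using FFW_series_sums[OF q, of l] by (simp_all add: sums_iff k P_def T_def)
  \<comment> \<open>The series of the theorem starts at index \<open>k\<close>; the earlier terms of
    \<open>kth_part_term\<close> vanish through the q-binomial or, at index 0, through the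
    weight.\<close>
  have Cf: "C * f n = P * kth_part_term q l (n + k)" for n
    using qpochhammer_inf_shift[OF q, of "n + k"]
    by (simp add: C_def f_def P_def kth_part_term_def[OF q] k mult_ac)
  have "kth_part_term q l m = 0" if "m < k" for m
    using that by (cases m) (simp_all add: kth_part_term_def[OF q] k q)
  then have "(\<lambda>n. kth_part_term q l (n + k)) sums T"
    using kth_part_term_sums[OF q, of l]
    by (subst sums_iff_shift) (simp add: T_def sums_iff)
  then have Cf_sums: "(\<lambda>n. C * f n) sums (P * T)"
    unfolding Cf by (rule sums_mult)
  \<comment> \<open>For \<open>q = 0\<close> the prefactor \<open>C\<close> can be 0, and then
    \<open>Cf_sums\<close> says nothing about \<open>f\<close>; there every \<open>f n\<close> is 0
    because of \<open>q ^ (n + k)\<close>.\<close>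
  have f: "summable f"
  proof (cases "q = 0")
    case True
    then show ?thesis using k by (simp add: f_def[abs_def])
  next
    case False
    then have "C \<noteq> 0" by (simp add: C_def)
    then show ?thesis
      using Cf_sums summable_cmult_iff[of C f] by (auto simp: sums_iff)
  qed
  have Cf_eq: "C * (\<Sum>n. f n) = P * T"
    using Cf_sums f by (simp add: sums_iff suminf_mult)
  have "P * T = - (\<Sum>j<k. euler_coeff q j * (D + of_nat j))"
  proof -
    have "P * T = - (\<Sum>j<k. P * (euler_coeff q j * (weighted_euler_series q q + of_nat j / P)))"
      using kth_part_term_sums[OF q, of l]
      by (simp add: sums_iff T_def k P_def sum_distrib_left del: sum.lessThan_Suc)
    moreover have "P * (euler_coeff q j * (weighted_euler_series q q + of_nat j / P))
        = euler_coeff q j * (D + of_nat j)" for j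
      using P by (simp add: D(2) distrib_left)
    ultimately show ?thesis by simp
  qed
  also have "(\<Sum>j<k. euler_coeff q j * (D + of_nat j))
      = (\<Sum>i<k. euler_coeff q i * D) + (\<Sum>j<k. of_nat j * euler_coeff q j)"
    by (simp add: distrib_left sum.distrib mult.commute)
  also have "\<dots> = (\<Sum>i<k. euler_coeff q i * (D - (\<Sum>n = 1..k - i - 1. q ^ n / (1 - q ^ n))))"
    unfolding sum_index_mult_euler_coeff[OF q] by (simp add: right_diff_distrib sum_subtractf)
  also have "{..<k} = {0..k - 1}" using k by auto
  finally have "P * T = - (\<Sum>i = 0..k - 1. (-1) ^ i * (q ^ (i * (i + 1) div 2) / qpochhammer q q i)
              * (D - (\<Sum>n = 1..k - i - 1. q ^ n / (1 - q ^ n))))"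
    unfolding euler_coeff_def .
  then show ?thesis
    using D(1) F f Cf_eq unfolding f_def C_def D_def by simp
qed

end
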